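(* Let $\mathcal{R}$ be an associative $\mathbb{C}$-algebra and let $N\in\mathcal{R}$ satisfy $N^\nu=0$ for some integer $\nu\ge1$. Let $f$ be a function that is holonomic (D-finite) locally at $0$: $f$ is analytic in a neighborhood of $0$ and satisfies a linear differential equation with polynomial coefficients $$p_r(z)f^{(r)}(z)+p_{r-1}(z)f^{(r-1)}(z)+\cdots+p_0(z)f(z)=0,$$ with initial conditions that determine its Taylor series $f(z)=\sum_{k=0}^\infty a_kz^k$. Then $$f(N)=\sum_{k=0}^{\nu-1}a_kN^k$$ exactly, and the coefficients $a_0,\dots,a_{\nu-1}$ are computable by the linear recurrence induced by the differential equation.
   Context: For $f(z)=\sum_{k\ge0}a_kz^k$ the evaluation at a nilpotent element is the formal sum $f(N):=\sum_{k\ge0}a_kN^k$. *)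

theory Defs
  imports "HOL-Complex_Analysis.Complex_Analysis" "HOL-Library.Groups_Big_Fun"
begin

text \<open>
  Unital associative complex algebras, not necessarily commutative. The sort
  \<open>{ring, monoid_mult}\<close> is used instead of \<open>ring_1\<close> so that the zero algebra is not excluded.
\<close>

locale complex_algebra = vector_space smul
  for smul :: "complex \<Rightarrow> 'a::{ring, monoid_mult} \<Rightarrow> 'a" +
  assumes smul_mult_left: "smul c x * y = smul c (x * y)"
    and smul_mult_right: "x * smul c y = smul c (x * y)"

definition taylor_coeff :: "(complex \<Rightarrow> complex) \<Rightarrow> nat \<Rightarrow> complex" where
  "taylor_coeff f k = fps_nth (fps_expansion f 0) k"

text \<open>
  The formal sum of all \<open>a\<^sub>k N\<^sup>k\<close>. No topology is involved: \<^const>\<open>Sum_any\<close> adds up the nonzero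
  terms, and it is meaningful here because there are only finitely many of them when \<open>N\<close> is
  nilpotent (lemma \<open>finite_nilpotent_eval_support\<close> below).
\<close>

definition nilpotent_eval ::
    "(complex \<Rightarrow> 'a::{ring, monoid_mult} \<Rightarrow> 'a) \<Rightarrow> (complex \<Rightarrow> complex) \<Rightarrow> 'a \<Rightarrow> 'a" where
  "nilpotent_eval smul f N = Sum_any (\<lambda>k. smul (taylor_coeff f k) (N ^ k))"

lemma (in complex_algebra) finite_nilpotent_eval_support:
  assumes "N ^ \<nu> = 0"
  shows "finite {k. smul (taylor_coeff f k) (N ^ k) \<noteq> 0}"
proof (rule finite_subset)
  show "{k. smul (taylor_coeff f k) (N ^ k) \<noteq> 0} \<subseteq> {..<\<nu>}"
  proof safe
    fix k assume *: "smul (taylor_coeff f k) (N ^ k) \<noteq> 0"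
    show "k < \<nu>"
    proof (rule ccontr)
      assume "\<not> k < \<nu>"
      then have "N ^ k = N ^ \<nu> * N ^ (k - \<nu>)"
        by (simp flip: power_add)
      with * assms show False by simp
    qed
  qed
qed simp

text \<open>
  The differential operator \<open>p\<^sub>r D\<^sup>r + \<dots> + p\<^sub>0\<close>, applied to functions and to formal power series.
  The formal version serves to say that initial values single out the Taylor series among all
  formal solutions. Among convergent solutions only, uniqueness would not make the recurrence
  solvable, since at an irregular singular point a free coefficient may lead to a divergent solution.
\<close>

definition diff_op :: "nat \<Rightarrow> (nat \<Rightarrow> complex poly) \<Rightarrow> (complex \<Rightarrow> complex) \<Rightarrow> complex \<Rightarrow> complex"
  where "diff_op r p f z = (\<Sum>i\<le>r. poly (p i) z * (deriv ^^ i) f z)"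

definition fps_diff_op :: "nat \<Rightarrow> (nat \<Rightarrow> complex poly) \<Rightarrow> complex fps \<Rightarrow> complex fps"
  where "fps_diff_op r p F = (\<Sum>i\<le>r. fps_of_poly (p i) * (fps_deriv ^^ i) F)"

text \<open>
  The coefficient of \<open>z\<^sup>n\<close> in the operator applied to \<open>z\<^sup>k\<close>. Here \<open>fact i * (k choose i)\<close> is the
  falling factorial \<open>k (k - 1) \<dots> (k - i + 1)\<close>. The recurrence induced by the differential
  equation is that the sum of \<open>rec_coeff r p n k * a\<^sub>k\<close> over \<open>k\<close> vanishes for every \<open>n\<close>, cf.
  lemma \<open>fps_nth_fps_diff_op\<close> below.
\<close>

definition rec_coeff :: "nat \<Rightarrow> (nat \<Rightarrow> complex poly) \<Rightarrow> nat \<Rightarrow> nat \<Rightarrow> complex" where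
  "rec_coeff r p n k =
     (\<Sum>i\<le>r. if k \<le> n + i then coeff (p i) (n + i - k) * of_nat (fact i * (k choose i)) else 0)"

lemma fps_nth_fps_deriv_power:
  "fps_nth ((fps_deriv ^^ i) F) n = of_nat (fact i * ((n + i) choose i)) * fps_nth F (n + i)"
  for F :: "complex fps"
proof (induction i arbitrary: n)
  case (Suc i)
  have "Suc n * ((Suc n + i) choose i) = Suc i * ((n + Suc i) choose Suc i)"
    using binomial_absorb_comp[of "Suc n + i" i] Suc_times_binomial_eq[of "n + i" i]
    by (simp add: mult.commute)
  then have "Suc n * (fact i * ((Suc n + i) choose i)) = fact (Suc i) * ((n + Suc i) choose Suc i)"
    by (metis (no_types, lifting) fact_Suc mult.assoc mult.commute of_nat_id)
  then have "of_nat (Suc n) * of_nat (fact i * ((Suc n + i) choose i)) =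
      (of_nat (fact (Suc i) * ((n + Suc i) choose Suc i)) :: complex)"
    by (metis of_nat_mult)
  with Suc[of "Suc n"] show ?case
    by (simp only: funpow.simps o_apply fps_deriv_nth flip: mult.assoc) simp
qed simp

lemma fps_nth_fps_diff_op:
  "fps_nth (fps_diff_op r p F) n = (\<Sum>k\<le>n + r. rec_coeff r p n k * fps_nth F k)"
proof -
  have *: "fps_nth (fps_of_poly (p i) * (fps_deriv ^^ i) F) n =
      (\<Sum>k\<le>n + r. (if k \<le> n + i then coeff (p i) (n + i - k) * of_nat (fact i * (k choose i)) else 0)
        * fps_nth F k)" (is "_ = sum ?g _") if "i \<le> r" for i
  proof -
    have "fps_nth (fps_of_poly (p i) * (fps_deriv ^^ i) F) n = (\<Sum>j=0..n. ?g (n - j + i))"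
      unfolding fps_mult_nth by (intro sum.cong) (auto simp: fps_nth_fps_deriv_power)
    also have "\<dots> = sum ?g {i..n + i}"
      by (rule sum.reindex_bij_witness[where i = "\<lambda>k. n + i - k" and j = "\<lambda>j. n - j + i"]) auto
    also have "\<dots> = sum ?g {..n + r}"
      using that by (intro sum.mono_neutral_left) (auto simp: not_le)
    finally show ?thesis .
  qed
  have "fps_nth (fps_diff_op r p F) n = (\<Sum>i\<le>r. \<Sum>k\<le>n + r.
      (if k \<le> n + i then coeff (p i) (n + i - k) * of_nat (fact i * (k choose i)) else 0) * fps_nth F k)"
    unfolding fps_diff_op_def fps_sum_nth using * by (intro sum.cong) auto
  also have "\<dots> = (\<Sum>k\<le>n + r. rec_coeff r p n k * fps_nth F k)"
    by (subst sum.swap) (simp add: rec_coeff_def sum_distrib_right)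
  finally show ?thesis .
qed

text \<open>
  The monomial \<open>z\<^sup>j D\<^sup>i\<close> maps \<open>z\<^sup>k\<close> to a multiple of \<open>z\<close> to the power \<open>k - (i - j)\<close>. With \<open>M\<close> the
  largest \<open>i - j\<close> that occurs (possibly negative), the \<open>n\<close>-th equation of the recurrence involves
  no index above \<open>n + M\<close>, so equation \<open>k - M\<close> is the one to solve for \<open>a\<^sub>k\<close>.
\<close>

definition rec_shift :: "nat \<Rightarrow> (nat \<Rightarrow> complex poly) \<Rightarrow> int" where
  "rec_shift r p = Max {int i - int j | i j. i \<le> r \<and> coeff (p i) j \<noteq> 0}"

lemma rec_coeff_eq_0:
  assumes "int n + rec_shift r p < int k"
  shows "rec_coeff r p n k = 0"
proof -
  let ?A = "{int i - int j | i j. i \<le> r \<and> coeff (p i) j \<noteq> 0}"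
  have "?A \<subseteq> (\<lambda>(i, j). int i - int j) ` (SIGMA i:{..r}. {..degree (p i)})"
    by (force simp: le_degree)
  then have fin: "finite ?A"
    by (rule finite_subset) auto
  have "coeff (p i) (n + i - k) = 0" if "i \<le> r" "k \<le> n + i" for i
  proof (rule ccontr)
    assume "coeff (p i) (n + i - k) \<noteq> 0"
    with that have "int i - int (n + i - k) \<in> ?A" by blast
    then have "int i - int (n + i - k) \<le> rec_shift r p"
      unfolding rec_shift_def by (rule Max_ge[OF fin])
    with that assms show False by simp
  qed
  then show ?thesis
    unfolding rec_coeff_def by (intro sum.neutral) auto
qed

definition rec_index :: "nat \<Rightarrow> (nat \<Rightarrow> complex poly) \<Rightarrow> nat \<Rightarrow> nat" where
  "rec_index r p k = nat (int k - rec_shift r p)"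

text \<open>
  Forward evaluation of the recurrence from the initial values \<open>y\<^sub>0, \<dots>, y\<^sub>s\<^sub>-\<^sub>1\<close> of
  \<open>f, f', \<dots>\<close> at \<open>0\<close>. It is a legitimate solution step for \<open>k \<ge> s\<close> only if
  \<open>rec_shift r p \<le> k\<close> (the equation exists) and the divisor is nonzero (the equation is solvable).
\<close>

function rec_solution ::
    "nat \<Rightarrow> (nat \<Rightarrow> complex poly) \<Rightarrow> nat \<Rightarrow> (nat \<Rightarrow> complex) \<Rightarrow> nat \<Rightarrow> complex" where
  "rec_solution r p s y k =
     (if k < s then y k / fact k
      else - (\<Sum>m<k. rec_coeff r p (rec_index r p k) m * rec_solution r p s y m)
             / rec_coeff r p (rec_index r p k) k)"
  by auto
termination
  by (relation "Wellfounded.measure (\<lambda>(r, p, s, y, k). k)") auto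

declare rec_solution.simps [simp del]

end

theory Submission
  imports Defs
begin

text \<open>
  The formula for \<open>f(N)\<close> only says that the terms from index \<open>\<nu>\<close> on vanish, and the recurrence is
  the differential equation transferred to the Taylor series. The substance of the theorem is that
  the recurrence can be solved forwards: when \<open>s\<close> initial values single out the Taylor series among
  all formal solutions, the coefficient of \<open>a\<^sub>k\<close> in the equation for \<open>a\<^sub>k\<close> is nonzero for every
  \<open>k \<ge> s\<close>.

  Let \<open>L\<close> be the operator and \<open>M\<close> its shift, so that \<open>L z\<^sup>k = c(k) z\<^sup>k\<^sup>-\<^sup>M + \<dots>\<close> with higher powers of
  \<open>z\<close> left out. The function \<open>c\<close> is the indicial polynomial. It is not zero, because \<open>M\<close> is
  attained, hence it has only finitely many zeros (lemma \<open>finite_exceptional\<close>). Suppose that it has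
  a zero \<open>k \<ge> s\<close>, and take the largest zero \<open>m\<close>. Then \<open>L z\<^sup>m\<close> starts at an index above \<open>m - M\<close>, and
  all later corrections are possible since \<open>c\<close> does not vanish beyond \<open>m\<close>. This gives a formal
  solution \<open>z\<^sup>m + \<dots>\<close> of the homogeneous equation (lemma \<open>ex_solution_at_last_exceptional\<close>). Its
  first \<open>s\<close> coefficients vanish, so adding it to the Taylor series of \<open>f\<close> changes no initial value,
  which contradicts uniqueness. Passing to the largest zero is essential: a solution started at a
  smaller zero might be obstructed at a later one.
\<close>

section \<open>The indicial polynomial\<close>

lemma finite_rec_shift_set:
  "finite {int i - int j | i j. i \<le> r \<and> coeff (p i) j \<noteq> (0 :: complex)}"
proof (rule finite_subset)
  show "{int i - int j | i j. i \<le> r \<and> coeff (p i) j \<noteq> 0}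
      \<subseteq> (\<lambda>(i, j). int i - int j) ` (SIGMA i:{..r}. {..degree (p i)})"
    by (force simp: le_degree)
qed auto

lemma rec_shift_attained:
  assumes "p r \<noteq> 0"
  obtains i j where "i \<le> r" "coeff (p i) j \<noteq> 0" "rec_shift r p = int i - int j"
proof -
  have "int r - int (degree (p r)) \<in> {int i - int j | i j. i \<le> r \<and> coeff (p i) j \<noteq> 0}"
    using assms leading_coeff_neq_0 by blast
  then have "rec_shift r p \<in> {int i - int j | i j. i \<le> r \<and> coeff (p i) j \<noteq> 0}"
    unfolding rec_shift_def by (intro Max_in finite_rec_shift_set) blast
  with that show ?thesis by blast
qed

lemma rec_shift_le:
  assumes "p r \<noteq> 0"
  shows "rec_shift r p \<le> int r"
  using rec_shift_attained[of p r] assms by force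

definition indicial_coeff :: "nat \<Rightarrow> (nat \<Rightarrow> complex poly) \<Rightarrow> nat \<Rightarrow> complex" where
  "indicial_coeff r p i =
     (if rec_shift r p \<le> int i then coeff (p i) (nat (int i - rec_shift r p)) else 0)"

text \<open>
  The product \<open>x (x - 1) \<dots> (x - i + 1)\<close> is the eigenvalue of \<open>z\<^sup>i D\<^sup>i\<close> on \<open>z\<^sup>x\<close>. The monomials
  that attain the shift \<open>M\<close> are those of the form \<open>z\<^sup>i\<^sup>-\<^sup>M D\<^sup>i\<close>, and only they contribute.
\<close>

definition indicial_poly :: "nat \<Rightarrow> (nat \<Rightarrow> complex poly) \<Rightarrow> complex poly" where
  "indicial_poly r p =
     (\<Sum>i\<le>r. smult (indicial_coeff r p i) (\<Prod>j<i. [:- of_nat j, 1:]))"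

lemma poly_indicial_poly_of_nat:
  "poly (indicial_poly r p) (of_nat k) =
     (\<Sum>i\<le>r. indicial_coeff r p i * of_nat (fact i * (k choose i)))"
proof -
  have "(\<Prod>j<i. of_nat k - of_nat j) = (of_nat (fact i * (k choose i)) :: complex)" for i
    using gbinomial_prod_rev[of "of_nat k :: complex" i]
    by (simp add: binomial_gbinomial atLeast0LessThan)
  then show ?thesis
    by (simp add: indicial_poly_def poly_sum poly_prod)
qed

lemma rec_coeff_rec_index:
  assumes "rec_shift r p \<le> int k"
  shows "rec_coeff r p (rec_index r p k) k = poly (indicial_poly r p) (of_nat k)"
proof -
  have n: "int (rec_index r p k) = int k - rec_shift r p"
    using assms by (simp add: rec_index_def)
  have "(k \<le> rec_index r p k + i) = (rec_shift r p \<le> int i)"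
    and "rec_index r p k + i - k = nat (int i - rec_shift r p)" for i
    using n by linarith+
  then show ?thesis
    unfolding rec_coeff_def poly_indicial_poly_of_nat indicial_coeff_def
    by (intro sum.cong) auto
qed

text \<open>
  In terms of falling factorials the indicial polynomial is in triangular form: at the least index
  \<open>d\<close> with a nonzero coefficient, the terms above \<open>d\<close> vanish along with \<open>d choose i\<close>.
\<close>

lemma indicial_poly_nonzero:
  assumes "p r \<noteq> 0"
  shows "indicial_poly r p \<noteq> 0"
proof -
  obtain i j where ij: "i \<le> r" "coeff (p i) j \<noteq> 0" "rec_shift r p = int i - int j"
    using rec_shift_attained assms .
  define d where "d = (LEAST i. indicial_coeff r p i \<noteq> 0)"
  have i: "indicial_coeff r p i \<noteq> 0"
    using ij by (simp add: indicial_coeff_def)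
  then have d: "indicial_coeff r p d \<noteq> 0" "d \<le> r"
    using ij(1) LeastI[of "\<lambda>i. indicial_coeff r p i \<noteq> 0"]
      Least_le[of "\<lambda>i. indicial_coeff r p i \<noteq> 0" i]
    by (auto simp: d_def)
  have "indicial_coeff r p i * of_nat (fact i * (d choose i)) = 0" if "i \<noteq> d" for i
  proof (cases "i < d")
    case True
    then show ?thesis using not_less_Least unfolding d_def by fastforce
  qed (use that in \<open>simp add: binomial_eq_0\<close>)
  then have "poly (indicial_poly r p) (of_nat d) =
      (\<Sum>i\<in>{d}. indicial_coeff r p i * of_nat (fact i * (d choose i)))"
    unfolding poly_indicial_poly_of_nat using d(2) by (intro sum.mono_neutral_right) auto
  with d(1) show ?thesis by auto
qed

text \<open>
  At these indices the equation in which \<open>a\<^sub>k\<close> should be the last unknown does not determine it.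
  For \<open>k < M\<close> the equation with number \<open>k - M\<close> does not exist, and \<^const>\<open>rec_index\<close> has the default
  value \<open>0\<close>, so this case has to be listed separately.
\<close>

definition exceptional :: "nat \<Rightarrow> (nat \<Rightarrow> complex poly) \<Rightarrow> nat \<Rightarrow> bool" where
  "exceptional r p k \<longleftrightarrow> int k < rec_shift r p \<or> rec_coeff r p (rec_index r p k) k = 0"

lemma finite_exceptional:
  assumes "p r \<noteq> 0"
  shows "finite {k. exceptional r p k}"
proof (rule finite_subset)
  show "{k. exceptional r p k} \<subseteq> {..<nat (rec_shift r p)} \<union>
      of_nat -` {x. poly (indicial_poly r p) x = 0}"
    by (auto simp: exceptional_def rec_coeff_rec_index)
  show "finite ({..<nat (rec_shift r p)} \<union>
      (of_nat -` {x. poly (indicial_poly r p) x = 0} :: nat set))"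
    using poly_roots_finite[OF indicial_poly_nonzero[of p r]] assms inj_of_nat
    by (simp add: finite_vimageI del: vimage_Collect_eq)
qed

section \<open>Solving the recurrence\<close>

text \<open>
  The last index that can occur in the equation for \<open>a\<^sub>k\<close> is \<open>k\<close> itself, and it lies within the
  range of summation because the shift is at most the order \<open>r\<close>.
\<close>

lemma recurrence_sum_split:
  assumes "p r \<noteq> 0" and "rec_shift r p \<le> int k"
  defines "n \<equiv> rec_index r p k"
  shows "(\<Sum>m\<le>n + r. rec_coeff r p n m * a m) =
    (\<Sum>m<k. rec_coeff r p n m * a m) + rec_coeff r p n k * a k"
proof -
  have n: "int n = int k - rec_shift r p"
    using assms(2) by (simp add: n_def rec_index_def)
  then have "k \<le> n + r"
    using rec_shift_le[of p r] assms(1) by linarith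
  moreover have "rec_coeff r p n m = 0" if "k < m" for m
    using that n by (intro rec_coeff_eq_0) simp
  ultimately have "(\<Sum>m\<le>n + r. rec_coeff r p n m * a m) = (\<Sum>m\<le>k. rec_coeff r p n m * a m)"
    by (intro sum.mono_neutral_right) auto
  then show ?thesis
    by (simp flip: lessThan_Suc_atMost)
qed

lemma rec_solution_step:
  assumes "p r \<noteq> 0" and "s \<le> k" and "\<not> exceptional r p k"
  defines "n \<equiv> rec_index r p k"
  shows "(\<Sum>m\<le>n + r. rec_coeff r p n m * rec_solution r p s y m) = 0"
  using assms recurrence_sum_split[of p r k "rec_solution r p s y"]
    rec_solution.simps[of r p s y k]
  by (auto simp: exceptional_def)

lemma eq_rec_solution:
  assumes "p r \<noteq> 0"
    and rec: "\<And>n. (\<Sum>k\<le>n + r. rec_coeff r p n k * a k) = 0"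
    and init: "\<And>k. k < s \<Longrightarrow> a k = y k / fact k"
    and "\<And>k. s \<le> k \<Longrightarrow> \<not> exceptional r p k"
  shows "a k = rec_solution r p s y k"
proof (induction k rule: less_induct)
  case (less k)
  show ?case
  proof (cases "k < s")
    case True
    then show ?thesis using init by (simp add: rec_solution.simps)
  next
    case False
    define n where "n = rec_index r p k"
    have *: "rec_shift r p \<le> int k" "rec_coeff r p n k \<noteq> 0"
      using assms(4)[of k] False by (auto simp: exceptional_def n_def)
    have "(\<Sum>m<k. rec_coeff r p n m * a m) + rec_coeff r p n k * a k = 0"
      using recurrence_sum_split[where p = p and r = r and a = a, OF assms(1) *(1)] rec[of n] by (simp add: n_def)
    then have "a k = - (\<Sum>m<k. rec_coeff r p n m * a m) / rec_coeff r p n k"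
      using *(2) by (simp add: field_simps add_eq_0_iff)
    also have "\<dots> = rec_solution r p s y k"
      using less False by (simp add: rec_solution.simps[of r p s y k] n_def)
    finally show ?thesis .
  qed
qed

text \<open>
  Forward evaluation from a multiple of \<open>z\<^sup>m\<close> satisfies every equation: those numbered above \<open>m - M\<close> by
  construction, the one numbered \<open>m - M\<close> because \<open>m\<close> is exceptional, and the earlier ones because
  they only see vanishing coefficients.
\<close>

lemma ex_solution_at_last_exceptional:
  assumes "p r \<noteq> 0" and m: "exceptional r p m"
    and last: "\<And>k. m < k \<Longrightarrow> \<not> exceptional r p k"
  obtains G where "fps_diff_op r p G = 0" "\<And>k. k < m \<Longrightarrow> fps_nth G k = 0" "fps_nth G m \<noteq> 0"
proof
  define g where "g = rec_solution r p (Suc m) (\<lambda>k. if k = m then 1 else 0)"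
  have g: "g k = 0" if "k < m" for k
    using that by (simp add: g_def rec_solution.simps)
  have "(\<Sum>k\<le>n + r. rec_coeff r p n k * g k) = 0" for n
  proof (cases "int m < int n + rec_shift r p")
    case True
    define k where "k = nat (int n + rec_shift r p)"
    have "n = rec_index r p k" and "m < k"
      using True by (auto simp: k_def rec_index_def)
    then show ?thesis
      using rec_solution_step[where p = p and r = r and s = "Suc m" and k = k, OF assms(1)] last[of k] by (simp add: g_def)
  next
    case False
    have "rec_coeff r p n k * g k = 0" for k
    proof (cases k m rule: linorder_cases)
      case equal
      show ?thesis
      proof (cases "int n + rec_shift r p = int m")
        case True
        then have "n = rec_index r p m" "\<not> int m < rec_shift r p"
          by (auto simp: rec_index_def)
        then show ?thesis using m equal by (simp add: exceptional_def)
      next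
        assume "int n + rec_shift r p \<noteq> int m"
        with False equal show ?thesis by (simp add: rec_coeff_eq_0)
      qed
    qed (use False g in \<open>auto simp: rec_coeff_eq_0\<close>)
    then show ?thesis by (intro sum.neutral) blast
  qed
  then show "fps_diff_op r p (Abs_fps g) = 0"
    by (simp add: fps_eq_iff fps_nth_fps_diff_op)
  show "fps_nth (Abs_fps g) k = 0" if "k < m" for k
    using g that by simp
  show "fps_nth (Abs_fps g) m \<noteq> 0"
    by (simp add: g_def rec_solution.simps)
qed

lemma fps_diff_op_add:
  "fps_diff_op r p (F + G) = fps_diff_op r p F + fps_diff_op r p G"
  by (simp add: fps_eq_iff fps_nth_fps_diff_op ring_distribs sum.distrib)

lemma unique_solution_imp_not_exceptional:
  assumes "p r \<noteq> 0" and F: "fps_diff_op r p F = 0"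
    and unique: "\<And>G. fps_diff_op r p G = 0 \<Longrightarrow>
      (\<And>k. k < s \<Longrightarrow> fps_nth G k = fps_nth F k) \<Longrightarrow> G = F"
    and "s \<le> k"
  shows "\<not> exceptional r p k"
proof
  assume k: "exceptional r p k"
  define m where "m = Max {k. exceptional r p k}"
  have fin: "finite {k. exceptional r p k}"
    using finite_exceptional[of p r] assms(1) .
  have "exceptional r p m"
    unfolding m_def using Max_in[OF fin] k by auto
  moreover have "k' \<le> m" if "exceptional r p k'" for k'
    unfolding m_def using Max_ge[OF fin] that by auto
  ultimately obtain G where G: "fps_diff_op r p G = 0"
      "\<And>k. k < m \<Longrightarrow> fps_nth G k = 0" "fps_nth G m \<noteq> 0" and "k \<le> m"
    using ex_solution_at_last_exceptional[where p = p and r = r and m = m, OF assms(1)] k by (metis not_le)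
  have "F + G = F"
    using F G(1,2) \<open>s \<le> k\<close> \<open>k \<le> m\<close> by (intro unique) (auto simp: fps_diff_op_add)
  with G(3) show False by simp
qed

section \<open>Transfer to the Taylor series\<close>

lemma has_fps_expansion_diff_op:
  assumes "f has_fps_expansion F"
  shows "diff_op r p f has_fps_expansion fps_diff_op r p F"
proof -
  have "poly (p i) has_fps_expansion fps_of_poly (p i)" for i
    by (simp add: has_fps_expansion_def)
  moreover have "(deriv ^^ i) f has_fps_expansion (fps_deriv ^^ i) F" for i
    by (induction i) (auto intro: assms has_fps_expansion_deriv)
  ultimately have "(\<lambda>z. \<Sum>i\<le>r. poly (p i) z * (deriv ^^ i) f z) has_fps_expansion fps_diff_op r p F"
    unfolding fps_diff_op_def
    by (intro has_fps_expansion_sum has_fps_expansion_mult)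
  then show ?thesis
    by (simp add: diff_op_def[abs_def])
qed

lemma fps_diff_op_fps_expansion_eq_0:
  assumes "f analytic_on {0}" and "\<forall>\<^sub>F z in nhds 0. diff_op r p f z = 0"
  shows "fps_diff_op r p (fps_expansion f 0) = 0"
proof -
  have "diff_op r p f has_fps_expansion fps_diff_op r p (fps_expansion f 0)"
    using assms(1) by (intro has_fps_expansion_diff_op analytic_at_imp_has_fps_expansion_0)
  moreover have "diff_op r p f has_fps_expansion 0"
    using has_fps_expansion_cong[OF assms(2) refl] has_fps_expansion_0 by simp
  ultimately show ?thesis
    using fps_expansion_unique_complex by blast
qed

lemma (in complex_algebra) nilpotent_eval_eq_sum:
  assumes "N ^ \<nu> = 0"
  shows "nilpotent_eval smul f N = (\<Sum>k<\<nu>. smul (taylor_coeff f k) (N ^ k))"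
  unfolding nilpotent_eval_def
proof (rule Sum_any.expand_superset)
  have "N ^ k = 0" if "\<nu> \<le> k" for k
    using that assms by (metis le_add_diff_inverse mult_zero_left power_add)
  then show "{k. smul (taylor_coeff f k) (N ^ k) \<noteq> 0} \<subseteq> {..<\<nu>}"
    by (auto simp: not_le[symmetric])
qed simp

theorem corollary8:
  fixes smul :: "complex \<Rightarrow> 'r::{ring, monoid_mult} \<Rightarrow> 'r"
    and N :: 'r
    and \<nu> r s :: nat
    and f :: "complex \<Rightarrow> complex"
    and p :: "nat \<Rightarrow> complex poly"
    and y :: "nat \<Rightarrow> complex"
  assumes "complex_algebra smul"
    and "\<nu> \<ge> 1" and "N ^ \<nu> = 0"
    and analytic: "f analytic_on {0}"
    and ode: "p r \<noteq> 0" "\<forall>\<^sub>F z in nhds 0. diff_op r p f z = 0"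
    and init: "\<And>k. k < s \<Longrightarrow> (deriv ^^ k) f 0 = y k"
    and init_determines:
      "\<And>G. fps_diff_op r p G = 0 \<Longrightarrow> (\<And>k. k < s \<Longrightarrow> fact k * fps_nth G k = y k) \<Longrightarrow>
        G = fps_expansion f 0"
  shows "(nilpotent_eval smul f N = (\<Sum>k<\<nu>. smul (taylor_coeff f k) (N ^ k))) \<and>
    (\<forall>n. (\<Sum>k\<le>n + r. rec_coeff r p n k * taylor_coeff f k) = 0) \<and>
    (\<forall>k\<in>{s..<\<nu>}. rec_shift r p \<le> int k \<and> rec_coeff r p (rec_index r p k) k \<noteq> 0) \<and>
    (\<forall>k<\<nu>. taylor_coeff f k = rec_solution r p s y k)"
proof -
  interpret complex_algebra smul by fact
  define F where "F = fps_expansion f 0"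
  have F: "fps_diff_op r p F = 0"
    unfolding F_def using analytic ode(2) by (rule fps_diff_op_fps_expansion_eq_0)
  have y: "fps_nth F k = y k / fact k" if "k < s" for k
    using init[OF that] by (simp add: F_def fps_expansion_def)
  have rec: "(\<Sum>k\<le>n + r. rec_coeff r p n k * taylor_coeff f k) = 0" for n
    using F fps_nth_fps_diff_op[of r p F n] by (simp add: taylor_coeff_def F_def)
  have regular: "\<not> exceptional r p k" if "s \<le> k" for k
  proof (rule unique_solution_imp_not_exceptional[where p = p and r = r, OF ode(1) F _ that])
    fix G assume "fps_diff_op r p G = 0" "\<And>k. k < s \<Longrightarrow> fps_nth G k = fps_nth F k"
    then show "G = F"
      unfolding F_def[symmetric] using init_determines[of G] y by (simp add: F_def)
  qed
  have "taylor_coeff f k = rec_solution r p s y k" for k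
    by (rule eq_rec_solution[where p = p and r = r, OF ode(1) rec _ regular]) (simp_all add: y taylor_coeff_def flip: F_def)
  moreover have "rec_shift r p \<le> int k \<and> rec_coeff r p (rec_index r p k) k \<noteq> 0"
    if "k \<in> {s..<\<nu>}" for k
    using regular[of k] that by (auto simp: exceptional_def)
  ultimately show ?thesis
    using nilpotent_eval_eq_sum[OF \<open>N ^ \<nu> = 0\<close>] rec by blast
qed

end
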